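(* Let $H_{\mathbb Z}$ be the discrete Hilbert transform on $\ell_4(\mathbb Z)$. Then $$\frac{6}{17\pi}\,\overline{\mathbb D}\subset W_e(H_{\mathbb Z})=\overline{W(H_{\mathbb Z})}.$$ In particular, $W_e(H_{\mathbb Z})$ has nonempty interior and is not contained in the imaginary axis.
   Context: $\overline{\mathbb D}=\{z\in\mathbb C:|z|\le1\}$. For finitely supported complex sequences $a=(a_n)_{n\in\mathbb Z}$ define $(Ha)_n:=\frac1\pi\sum_{m\in\mathbb Z\setminus\{0\}}\frac{a_{n-m}}{m}$, $n\in\mathbb Z$. By the discrete M. Riesz theorem $H$ extends uniquely to a bounded operator on $\ell_p(\mathbb Z)$, $1<p<\infty$; this extension (here for $p=4$) is the discrete Hilbert transform $H_{\mathbb Z}$. The dual of $\ell_4(\mathbb Z)$ is identified with $\ell_{4/3}(\mathbb Z)$ via $\langle x,y\rangle=\sum_{j\in\mathbb Z} x_j\overline{y_j}$, and $J(x)=(x_j|x_j|^2)_{j\in\mathbb Z}$ for $x=(x_j)\in\ell_4(\mathbb Z)$. For a bounded operator $T$ on $\ell_4(\mathbb Z)$, the numerical range is $W(T)=\{\langle Tx,J(x)\rangle:\ \|x\|_4=1\}$, and the essential numerical range $W_e(T)$ is the set of all $\lambda\in\mathbb C$ for which there is a net (equivalently, a sequence) of unit vectors $x_\alpha\in\ell_4(\mathbb Z)$ with $x_\alpha\to0$ weakly and $\langle Tx_\alpha,J(x_\alpha)\rangle\to\lambda$. *)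

theory Defs
  imports "HOL-Analysis.Analysis"
begin

definition ell :: "real \<Rightarrow> (int \<Rightarrow> complex) set" where
  "ell p = {x. (\<lambda>j. norm (x j) powr p) summable_on UNIV}"

definition ell_norm :: "real \<Rightarrow> (int \<Rightarrow> complex) \<Rightarrow> real" where
  "ell_norm p x = (\<Sum>\<^sub>\<infinity>j. norm (x j) powr p) powr (1 / p)"

(* Operators on the carrier set ell p are functions that take the value undefined outside
   ell p (this is what the extensional function space expresses), so that equality of
   operators is equality of functions. *)
definition bounded_operator ::
    "real \<Rightarrow> ((int \<Rightarrow> complex) \<Rightarrow> (int \<Rightarrow> complex)) \<Rightarrow> bool" where
  "bounded_operator p T \<longleftrightarrow>
     T \<in> ell p \<rightarrow>\<^sub>E ell p \<and>
     (\<forall>x\<in>ell p. \<forall>y\<in>ell p. T (\<lambda>j. x j + y j) = (\<lambda>j. T x j + T y j)) \<and>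
     (\<forall>c. \<forall>x\<in>ell p. T (\<lambda>j. c * x j) = (\<lambda>j. c * T x j)) \<and>
     (\<exists>C. \<forall>x\<in>ell p. ell_norm p (T x) \<le> C * ell_norm p x)"

definition finitely_supported :: "(int \<Rightarrow> complex) \<Rightarrow> bool" where
  "finitely_supported a \<longleftrightarrow> finite {n. a n \<noteq> 0}"

(* Used only for finitely supported a, where the sum has finitely many nonzero terms. *)
definition hilbert_sum :: "(int \<Rightarrow> complex) \<Rightarrow> int \<Rightarrow> complex" where
  "hilbert_sum a n = complex_of_real (1 / pi) * (\<Sum>\<^sub>\<infinity>m\<in>UNIV - {0}. a (n - m) / of_int m)"

(* For 1 < p < \<infinity> such an operator exists by the discrete M. Riesz theorem and is unique
   because the finitely supported sequences are dense in ell p. *)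
definition discrete_hilbert_transform ::
    "real \<Rightarrow> (int \<Rightarrow> complex) \<Rightarrow> (int \<Rightarrow> complex)" where
  "discrete_hilbert_transform p =
     (THE T. bounded_operator p T \<and> (\<forall>a. finitely_supported a \<longrightarrow> T a = hilbert_sum a))"

definition pairing :: "(int \<Rightarrow> complex) \<Rightarrow> (int \<Rightarrow> complex) \<Rightarrow> complex" where
  "pairing x y = (\<Sum>\<^sub>\<infinity>j. x j * cnj (y j))"

definition duality_map :: "(int \<Rightarrow> complex) \<Rightarrow> (int \<Rightarrow> complex)" where
  "duality_map x = (\<lambda>j. x j * complex_of_real ((norm (x j))\<^sup>2))"

(* Weak convergence to 0 in ell 4, whose dual is identified with ell (4/3) via the pairing. *)
definition weakly_null :: "(nat \<Rightarrow> int \<Rightarrow> complex) \<Rightarrow> bool" where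
  "weakly_null X \<longleftrightarrow> (\<forall>y\<in>ell (4/3). (\<lambda>k. pairing (X k) y) \<longlonglongrightarrow> 0)"

definition numerical_range ::
    "((int \<Rightarrow> complex) \<Rightarrow> (int \<Rightarrow> complex)) \<Rightarrow> complex set" where
  "numerical_range T =
     {pairing (T x) (duality_map x) |x. x \<in> ell 4 \<and> ell_norm 4 x = 1}"

definition essential_numerical_range ::
    "((int \<Rightarrow> complex) \<Rightarrow> (int \<Rightarrow> complex)) \<Rightarrow> complex set" where
  "essential_numerical_range T =
     {l. \<exists>X. (\<forall>k. X k \<in> ell 4 \<and> ell_norm 4 (X k) = 1) \<and> weakly_null X \<and>
             (\<lambda>k. pairing (T (X k)) (duality_map (X k))) \<longlonglongrightarrow> l}"

end

theory Submission
  imports Defs "HOL-Real_Asymp.Real_Asymp"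
begin

text \<open>
The kernel \<open>1 / (n - k)\<close> is translation-invariant, which makes the essential
numerical range equal to the closure of the numerical range: a unit vector may be translated
arbitrarily far without changing the value of the form, and vectors that are translated far enough
form a weakly null sequence (\<open>closure_numerical_range_subset\<close>). The other inclusion holds for
every operator.

The disc already appears on vectors with two adjacent nonzero entries. If the moduli of the entries
have ratio \<open>q\<close>, then varying the relative phase traces out an ellipse around the origin
(\<open>two_point_vector_value\<close>). The semi-axes are \<open>6 / (17 * pi)\<close> and
\<open>10 / (17 * pi)\<close> for \<open>q = 1/2\<close> and the ellipse shrinks to the origin as \<open>q\<close> tends
to zero, so by continuity the ellipses cover the disc (\<open>ellipse_parameters\<close>).

Both arguments need the transform as an operator on \<open>ell 4\<close>, given there by its defining
series, and its existence is a boundedness statement. The key is Cotlar's identity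
\<open>(h a)\<^sup>2 = 2 * h (a * h a) + Q (a\<^sup>2) + 2 * a * Q a\<close> for the transform \<open>h\<close> with kernel
\<open>1 / (n - k)\<close> and the convolution \<open>Q\<close> with kernel \<open>1 / (n - k)\<^sup>2\<close>
(\<open>hilbert_kernel_sum_power2\<close>). Summing it over all integers makes the first term on the right
disappear and gives Hilbert's inequality in \<open>\<ell>\<^sub>2\<close>; squaring it, summing, and using Hilbert's
inequality for the first term gives boundedness in \<open>\<ell>\<^sub>4\<close>
(\<open>sum_hilbert_kernel_sum_power4_le\<close>). Uniqueness of the bounded extension comes from the
density of the finitely supported sequences (\<open>bounded_operator_eqI\<close>).
\<close>

section \<open>Convolution with the inverse squares\<close>

lemma finite_int_subset_symmetric_interval:
  fixes F :: "int set"
  assumes "finite F"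
  obtains M where "F \<subseteq> {- int M..int M}"
proof -
  obtain k where "F \<subseteq> {i. \<bar>i\<bar> \<le> k}"
    using assms finite_int_iff_bounded_le by blast
  then show ?thesis by (intro that[of "nat k"]) force
qed

lemma sum_inverse_squares_le:
  fixes F :: "int set"
  assumes "finite F"
  shows "(\<Sum>m\<in>F. 1 / (real_of_int m)\<^sup>2) \<le> 4"
proof -
  obtain M where M: "F \<subseteq> {- int M..int M}"
    using finite_int_subset_symmetric_interval[OF assms] .
  define N where "N = Suc M"
  have sub: "F \<subseteq> {- int N..int N}" using M by (auto simp: N_def)
  \<comment> \<open>The sharper bound makes the induction telescope.\<close>
  have "(\<Sum>m\<in>{- int (Suc n)..int (Suc n)}. 1 / (real_of_int m)\<^sup>2) \<le> 4 - 2 / real (Suc n)" for n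
  proof (induction n)
    case 0
    have "{- int (Suc 0)..int (Suc 0)} = {-1, 0, 1}" by auto
    then show ?case by simp
  next
    case (Suc n)
    have "{- int (Suc (Suc n))..int (Suc (Suc n))} =
        insert (- int (Suc (Suc n))) (insert (int (Suc (Suc n))) {- int (Suc n)..int (Suc n)})"
      by auto
    then have "(\<Sum>m\<in>{- int (Suc (Suc n))..int (Suc (Suc n))}. 1 / (real_of_int m)\<^sup>2)
        = 2 / (real n + 2)\<^sup>2 + (\<Sum>m\<in>{- int (Suc n)..int (Suc n)}. 1 / (real_of_int m)\<^sup>2)"
      by (simp add: power2_eq_square algebra_simps)
    moreover have "2 / (real n + 2)\<^sup>2 \<le> 2 / real (Suc n) - 2 / real (Suc (Suc n))"
    proof -
      have "2 / (real n + 2)\<^sup>2 \<le> 2 / ((real n + 1) * (real n + 2))"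
        by (intro divide_left_mono) (auto simp: power2_eq_square)
      also have "\<dots> = 2 / real (Suc n) - 2 / real (Suc (Suc n))"
        by (simp add: field_simps)
      finally show ?thesis .
    qed
    ultimately show ?case using Suc.IH by linarith
  qed
  from this[of "N - 1"] have "(\<Sum>m\<in>{- int N..int N}. 1 / (real_of_int m)\<^sup>2) \<le> 4 - 2 / real N"
    by (simp add: N_def)
  moreover have "(\<Sum>m\<in>F. 1 / (real_of_int m)\<^sup>2) \<le> (\<Sum>m\<in>{- int N..int N}. 1 / (real_of_int m)\<^sup>2)"
    by (rule sum_mono2) (use sub in auto)
  moreover have "0 \<le> 2 / real N" by simp
  ultimately show ?thesis by linarith
qed

lemma sum_inverse_square_differences_le:
  fixes F :: "int set"
  assumes "finite F"
  shows "(\<Sum>k\<in>F. 1 / (real_of_int (n - k))\<^sup>2) \<le> 4"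
    and "(\<Sum>k\<in>F. 1 / (real_of_int (k - n))\<^sup>2) \<le> 4"
proof -
  have "(\<Sum>k\<in>F. 1 / (real_of_int (n - k))\<^sup>2) = (\<Sum>m\<in>(\<lambda>k. n - k) ` F. 1 / (real_of_int m)\<^sup>2)"
    by (subst sum.reindex) (auto simp: inj_on_def)
  also have "\<dots> \<le> 4" using assms by (intro sum_inverse_squares_le) auto
  finally show 1: "(\<Sum>k\<in>F. 1 / (real_of_int (n - k))\<^sup>2) \<le> 4" .
  have "(\<Sum>k\<in>F. 1 / (real_of_int (k - n))\<^sup>2) = (\<Sum>k\<in>F. 1 / (real_of_int (n - k))\<^sup>2)"
    by (intro sum.cong refl) (simp add: power2_commute)
  with 1 show "(\<Sum>k\<in>F. 1 / (real_of_int (k - n))\<^sup>2) \<le> 4" by simp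
qed

text \<open>Division by zero yields zero, so the diagonal term \<open>k = n\<close> drops out by itself. Sums over
finite sets of real numbers suffice for the estimates: the kernel is real, so real and imaginary
parts can be treated separately, and the constants do not matter.\<close>

definition hilbert_kernel_sum :: "int set \<Rightarrow> (int \<Rightarrow> real) \<Rightarrow> int \<Rightarrow> real" where
  "hilbert_kernel_sum K a n = (\<Sum>k\<in>K. a k / real_of_int (n - k))"

definition square_kernel_sum :: "int set \<Rightarrow> (int \<Rightarrow> real) \<Rightarrow> int \<Rightarrow> real" where
  "square_kernel_sum K a n = (\<Sum>k\<in>K. a k / (real_of_int (n - k))\<^sup>2)"

text \<open>Convolution with a summable kernel is bounded on every \<open>\<ell>\<^sub>p\<close>. This lemma is the case
\<open>p = 1\<close>; the cases \<open>p = 2\<close> and \<open>p = 4\<close> below follow from it by one and two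
applications of the Cauchy-Schwarz inequality.\<close>

lemma sum_square_kernel_sum_le:
  assumes "finite F" "finite K" "\<And>k. 0 \<le> a k"
  shows "(\<Sum>n\<in>F. square_kernel_sum K a n) \<le> 4 * (\<Sum>k\<in>K. a k)"
proof -
  have "(\<Sum>n\<in>F. square_kernel_sum K a n) = (\<Sum>k\<in>K. a k * (\<Sum>n\<in>F. 1 / (real_of_int (n - k))\<^sup>2))"
    unfolding square_kernel_sum_def by (subst sum.swap) (simp add: sum_distrib_left)
  also have "\<dots> \<le> (\<Sum>k\<in>K. a k * 4)"
    using assms by (intro sum_mono mult_left_mono sum_inverse_square_differences_le) auto
  finally show ?thesis by (simp flip: sum_distrib_right)
qed

lemma square_kernel_sum_power2_le:
  assumes "finite K"
  shows "(square_kernel_sum K a n)\<^sup>2 \<le> 4 * square_kernel_sum K (\<lambda>k. (a k)\<^sup>2) n"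
proof -
  define w where "w k = 1 / \<bar>real_of_int (n - k)\<bar>" for k
  have w2: "(w k)\<^sup>2 = 1 / (real_of_int (n - k))\<^sup>2" for k
    by (simp add: w_def power_divide)
  have "(\<Sum>k\<in>K. w k * (w k * a k))\<^sup>2 \<le> (\<Sum>k\<in>K. (w k)\<^sup>2) * (\<Sum>k\<in>K. (w k * a k)\<^sup>2)"
    by (rule Cauchy_Schwarz_ineq_sum)
  also have "\<dots> \<le> 4 * (\<Sum>k\<in>K. (w k * a k)\<^sup>2)"
    using sum_inverse_square_differences_le(1)[OF assms, of n]
    by (intro mult_right_mono) (auto simp: w2 intro: sum_nonneg)
  finally show ?thesis
    by (simp add: square_kernel_sum_def power_mult_distrib w2 w2[unfolded power2_eq_square]
        mult.assoc[symmetric] power2_eq_square[symmetric])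
qed

lemma sum_square_kernel_sum_power2_le:
  assumes "finite F" "finite K"
  shows "(\<Sum>n\<in>F. (square_kernel_sum K a n)\<^sup>2) \<le> 16 * (\<Sum>k\<in>K. (a k)\<^sup>2)"
proof -
  have "(\<Sum>n\<in>F. (square_kernel_sum K a n)\<^sup>2) \<le> (\<Sum>n\<in>F. 4 * square_kernel_sum K (\<lambda>k. (a k)\<^sup>2) n)"
    by (intro sum_mono square_kernel_sum_power2_le assms)
  also have "\<dots> \<le> 4 * (4 * (\<Sum>k\<in>K. (a k)\<^sup>2))"
    unfolding sum_distrib_left[symmetric]
    by (intro mult_left_mono sum_square_kernel_sum_le assms) auto
  finally show ?thesis by simp
qed

lemma sum_square_kernel_sum_power4_le:
  assumes "finite F" "finite K"
  shows "(\<Sum>n\<in>F. (square_kernel_sum K a n) ^ 4) \<le> 256 * (\<Sum>k\<in>K. (a k) ^ 4)"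
proof -
  have "(square_kernel_sum K a n) ^ 4 \<le> 16 * (square_kernel_sum K (\<lambda>k. (a k)\<^sup>2) n)\<^sup>2" for n
    using power_mono[OF square_kernel_sum_power2_le[OF assms(2), of a n], of 2]
    by (simp add: power_mult_distrib flip: power_mult)
  then have "(\<Sum>n\<in>F. (square_kernel_sum K a n) ^ 4)
      \<le> 16 * (\<Sum>n\<in>F. (square_kernel_sum K (\<lambda>k. (a k)\<^sup>2) n)\<^sup>2)"
    unfolding sum_distrib_left by (rule sum_mono)
  also have "\<dots> \<le> 16 * (16 * (\<Sum>k\<in>K. ((a k)\<^sup>2)\<^sup>2))"
    by (intro mult_left_mono sum_square_kernel_sum_power2_le assms) auto
  finally show ?thesis by (simp flip: power_mult)
qed

section \<open>Cotlar's identity and the estimates it yields\<close>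

text \<open>For pairwise distinct indices this is partial fractions. With \<open>1 / 0 = 0\<close> the partial fraction
formula can fail only when two of the indices coincide, and the last three summands are the
corrections for these cases.\<close>

lemma hilbert_kernel_product:
  fixes n k l :: int
  shows "1 / real_of_int (n - k) * (1 / real_of_int (n - l)) =
      1 / real_of_int (k - l) * (1 / real_of_int (n - k)) + 1 / real_of_int (l - k) * (1 / real_of_int (n - l))
      + (if k = l then 1 / (real_of_int (n - k))\<^sup>2 else 0)
      + (if n = k then 1 / (real_of_int (k - l))\<^sup>2 else 0) + (if n = l then 1 / (real_of_int (l - k))\<^sup>2 else 0)"
proof (cases "k = l \<or> n = k \<or> n = l")
  case True
  have cancel: "1 / (e * d) + 1 / (d * d) = 0" if "e = - d" for d e :: real
    using that by simp
  have "1 / ((real_of_int i - real_of_int j) * (real_of_int j - real_of_int i))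
      + 1 / ((real_of_int j - real_of_int i) * (real_of_int j - real_of_int i)) = 0" for i j
    by (rule cancel) simp
  from this[of k l] this[of l k] True show ?thesis
    by (auto simp: power2_eq_square mult.commute)
next
  case False
  have partial_fractions: "1 / x * (1 / y) = 1 / (y - x) * (1 / x) + 1 / (x - y) * (1 / y)"
    if "x \<noteq> 0" "y \<noteq> 0" "y - x \<noteq> 0" "x - y \<noteq> 0" for x y :: real
    using that by (simp add: divide_simps) (simp add: algebra_simps)
  from partial_fractions[of "real_of_int (n - k)" "real_of_int (n - l)"] False show ?thesis
    by simp
qed

text \<open>Cotlar's identity, discrete form. Expanding the square and inserting
\<open>hilbert_kernel_product\<close>, the first two summands of that formula each give
\<open>h (a * h a)\<close>, and the diagonal corrections give the terms with the square kernel. It expresses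
a square of the transform through the transform of a product, which is what allows passing from
\<open>\<ell>\<^sub>2\<close> to \<open>\<ell>\<^sub>4\<close>.\<close>

lemma hilbert_kernel_sum_power2:
  assumes K: "finite K" and a: "\<And>k. k \<notin> K \<Longrightarrow> a k = 0"
  shows "(hilbert_kernel_sum K a n)\<^sup>2 =
      2 * hilbert_kernel_sum K (\<lambda>k. a k * hilbert_kernel_sum K a k) n
      + square_kernel_sum K (\<lambda>k. (a k)\<^sup>2) n + 2 * (a n * square_kernel_sum K a n)"
proof -
  define f where "f k l = a k * a l * (1 / real_of_int (k - l) * (1 / real_of_int (n - k)))" for k l
  define g where "g k l = a k * a l * (if n = k then 1 / (real_of_int (k - l))\<^sup>2 else 0)" for k l
  have "(hilbert_kernel_sum K a n)\<^sup>2 =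
      (\<Sum>k\<in>K. \<Sum>l\<in>K. a k * a l * (1 / real_of_int (n - k) * (1 / real_of_int (n - l))))"
    by (simp add: hilbert_kernel_sum_def power2_eq_square sum_product)
  also have "\<dots> = (\<Sum>k\<in>K. \<Sum>l\<in>K. f k l + f l k
        + (if k = l then (a k)\<^sup>2 / (real_of_int (n - k))\<^sup>2 else 0) + g k l + g l k)"
    unfolding hilbert_kernel_product f_def g_def
    by (intro sum.cong refl) (simp add: algebra_simps power2_eq_square)
  also have "\<dots> = (\<Sum>k\<in>K. \<Sum>l\<in>K. f k l) + (\<Sum>k\<in>K. \<Sum>l\<in>K. f l k)
      + square_kernel_sum K (\<lambda>k. (a k)\<^sup>2) n + (\<Sum>k\<in>K. \<Sum>l\<in>K. g k l) + (\<Sum>k\<in>K. \<Sum>l\<in>K. g l k)"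
    using K by (simp add: sum.distrib square_kernel_sum_def)
  also have "(\<Sum>k\<in>K. \<Sum>l\<in>K. f l k) = (\<Sum>k\<in>K. \<Sum>l\<in>K. f k l)" by (rule sum.swap)
  also have "(\<Sum>k\<in>K. \<Sum>l\<in>K. g l k) = (\<Sum>k\<in>K. \<Sum>l\<in>K. g k l)" by (rule sum.swap)
  also have "(\<Sum>k\<in>K. \<Sum>l\<in>K. f k l) = hilbert_kernel_sum K (\<lambda>k. a k * hilbert_kernel_sum K a k) n"
    by (simp add: hilbert_kernel_sum_def f_def sum_distrib_left sum_divide_distrib)
  also have "(\<Sum>k\<in>K. \<Sum>l\<in>K. g k l) = a n * square_kernel_sum K a n"
  proof -
    have "(\<Sum>k\<in>K. \<Sum>l\<in>K. g k l) = (\<Sum>k\<in>K. if n = k then a n * square_kernel_sum K a n else 0)"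
      by (intro sum.cong refl) (auto simp: g_def square_kernel_sum_def sum_distrib_left)
    also have "\<dots> = a n * square_kernel_sum K a n"
      using K a by auto
    finally show ?thesis .
  qed
  finally show ?thesis by simp
qed

text \<open>For \<open>k = 0\<close> the sum vanishes by antisymmetry, and moving \<open>k\<close> by one changes it only by
two boundary terms, which tend to zero.\<close>

lemma symmetric_harmonic_tendsto_0:
  "(\<lambda>N. \<Sum>n\<in>{- int N..int N}. 1 / real_of_int (n - k)) \<longlonglongrightarrow> 0"
proof -
  define s where "s k N = (\<Sum>n\<in>{- int N..int N}. 1 / real_of_int (n - k))" for k N
  have step: "s (k + 1) N = s k N + (1 / (- real N - k - 1) - 1 / (real N - k))" for k N
  proof -
    have "s (k + 1) N = (\<Sum>n\<in>{- int N - 1..int N - 1}. 1 / real_of_int (n - k))"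
      unfolding s_def by (rule sum.reindex_bij_witness[of _ "\<lambda>n. n + 1" "\<lambda>n. n - 1"]) auto
    moreover have "(\<Sum>n\<in>{- int N - 1..int N}. 1 / real_of_int (n - k)) = s k N + 1 / (- real N - k - 1)"
    proof -
      have "{- int N - 1..int N} = insert (- int N - 1) {- int N..int N}" by auto
      then show ?thesis by (simp add: s_def algebra_simps)
    qed
    moreover have "(\<Sum>n\<in>{- int N - 1..int N}. 1 / real_of_int (n - k))
        = (\<Sum>n\<in>{- int N - 1..int N - 1}. 1 / real_of_int (n - k)) + 1 / (real N - k)"
    proof -
      have "{- int N - 1..int N} = insert (int N) {- int N - 1..int N - 1}" by auto
      then show ?thesis by (simp add: algebra_simps)
    qed
    ultimately show ?thesis by linarith
  qed
  have lim: "(\<lambda>N. 1 / (- real N - real_of_int k - 1) - 1 / (real N - k)) \<longlonglongrightarrow> 0" for k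
    by real_asymp
  have "s k \<longlonglongrightarrow> 0"
  proof (induction k rule: int_induct[where k = 0])
    case base
    have "s 0 N = - s 0 N" for N
    proof -
      have "s 0 N = (\<Sum>n\<in>{- int N..int N}. 1 / real_of_int (- n))"
        unfolding s_def by (rule sum.reindex_bij_witness[of _ uminus uminus]) auto
      then show ?thesis by (simp add: s_def sum_negf)
    qed
    then have "s 0 = (\<lambda>N. 0)" by (intro ext) (metis equal_neg_zero)
    then show ?case by simp
  next
    case (step1 i)
    then show ?case using tendsto_add[OF step1(2) lim[of i]] by (simp add: step[abs_def] step)
  next
    case (step2 i)
    have "s (i - 1) = (\<lambda>N. s i N - (1 / (- real N - of_int (i - 1) - 1) - 1 / (real N - of_int (i - 1))))"
      using step[of "i - 1"] by (intro ext) simp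
    then show ?case using tendsto_diff[OF step2(2) lim[of "i - 1"]] by simp
  qed
  then show ?thesis by (simp add: s_def[abs_def])
qed


text \<open>The transform of a finitely supported sequence has mean zero. This disposes of the term
\<open>h (a * h a)\<close> when Cotlar's identity is summed.\<close>

lemma sum_hilbert_kernel_sum_tendsto_0:
  "(\<lambda>N. \<Sum>n\<in>{- int N..int N}. hilbert_kernel_sum K b n) \<longlonglongrightarrow> 0"
proof -
  have "(\<Sum>n\<in>{- int N..int N}. hilbert_kernel_sum K b n)
      = (\<Sum>k\<in>K. b k * (\<Sum>n\<in>{- int N..int N}. 1 / real_of_int (n - k)))" for N
    unfolding hilbert_kernel_sum_def by (subst sum.swap) (simp add: sum_distrib_left)
  moreover have "(\<lambda>N. \<Sum>k\<in>K. b k * (\<Sum>n\<in>{- int N..int N}. 1 / real_of_int (n - k)))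
      \<longlonglongrightarrow> (\<Sum>k\<in>K. b k * 0)"
    by (intro tendsto_sum tendsto_mult tendsto_const symmetric_harmonic_tendsto_0)
  ultimately show ?thesis by simp
qed

text \<open>Schur's test: the inequality \<open>2 * a n * a k \<le> (a n)\<^sup>2 + (a k)\<^sup>2\<close> reduces the quadratic form
to row sums of the kernel.\<close>

lemma sum_mult_square_kernel_sum_le:
  assumes "finite K"
  shows "(\<Sum>n\<in>K. a n * square_kernel_sum K a n) \<le> 4 * (\<Sum>k\<in>K. (a k)\<^sup>2)"
proof -
  have "a n * square_kernel_sum K a n
      \<le> 2 * (a n)\<^sup>2 + square_kernel_sum K (\<lambda>k. (a k)\<^sup>2) n / 2" for n
  proof -
    have "a n * a k / (real_of_int (n - k))\<^sup>2
        \<le> ((a n)\<^sup>2 / 2 + (a k)\<^sup>2 / 2) / (real_of_int (n - k))\<^sup>2" for k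
      using sum_squares_bound[of "a n" "a k"] by (intro divide_right_mono) auto
    then have "(\<Sum>k\<in>K. a n * a k / (real_of_int (n - k))\<^sup>2)
        \<le> (\<Sum>k\<in>K. ((a n)\<^sup>2 / 2 + (a k)\<^sup>2 / 2) / (real_of_int (n - k))\<^sup>2)"
      by (rule sum_mono)
    then have "a n * square_kernel_sum K a n
        \<le> (a n)\<^sup>2 / 2 * (\<Sum>k\<in>K. 1 / (real_of_int (n - k))\<^sup>2)
          + square_kernel_sum K (\<lambda>k. (a k)\<^sup>2) n / 2"
      by (simp add: square_kernel_sum_def sum_distrib_left add_divide_distrib sum.distrib
          sum_divide_distrib mult.commute)
    also have "(a n)\<^sup>2 / 2 * (\<Sum>k\<in>K. 1 / (real_of_int (n - k))\<^sup>2) \<le> (a n)\<^sup>2 / 2 * 4"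
      using assms by (intro mult_left_mono sum_inverse_square_differences_le) auto
    finally show ?thesis by simp
  qed
  then have "(\<Sum>n\<in>K. a n * square_kernel_sum K a n)
      \<le> (\<Sum>n\<in>K. 2 * (a n)\<^sup>2 + square_kernel_sum K (\<lambda>k. (a k)\<^sup>2) n / 2)"
    by (rule sum_mono)
  also have "\<dots> = 2 * (\<Sum>n\<in>K. (a n)\<^sup>2) + (\<Sum>n\<in>K. square_kernel_sum K (\<lambda>k. (a k)\<^sup>2) n) / 2"
    by (simp add: sum.distrib sum_distrib_left sum_divide_distrib)
  also have "\<dots> \<le> 4 * (\<Sum>k\<in>K. (a k)\<^sup>2)"
    using sum_square_kernel_sum_le[OF assms assms, of "\<lambda>k. (a k)\<^sup>2"] by simp
  finally show ?thesis .
qed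

text \<open>Hilbert's inequality. Sum Cotlar's identity over a symmetric interval that contains \<open>F\<close>: the
two square kernel terms contribute at most \<open>4 + 2 * 4 = 12\<close> times the right-hand side, and the
remaining term vanishes as the interval grows.\<close>

lemma sum_hilbert_kernel_sum_power2_le:
  assumes F: "finite F" and K: "finite K" and a: "\<And>k. k \<notin> K \<Longrightarrow> a k = 0"
  shows "(\<Sum>n\<in>F. (hilbert_kernel_sum K a n)\<^sup>2) \<le> 12 * (\<Sum>k\<in>K. (a k)\<^sup>2)"
proof -
  define b where "b k = a k * hilbert_kernel_sum K a k" for k
  define \<epsilon> where "\<epsilon> N = 2 * (\<Sum>n\<in>{- int N..int N}. hilbert_kernel_sum K b n)" for N
  have "\<epsilon> \<longlonglongrightarrow> 2 * 0"
    unfolding \<epsilon>_def by (intro tendsto_mult tendsto_const sum_hilbert_kernel_sum_tendsto_0)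
  then have lim: "(\<lambda>N. 12 * (\<Sum>k\<in>K. (a k)\<^sup>2) + \<epsilon> N) \<longlonglongrightarrow> 12 * (\<Sum>k\<in>K. (a k)\<^sup>2)"
    using tendsto_add[OF tendsto_const] by fastforce
  obtain M where M: "F \<union> K \<subseteq> {- int M..int M}"
    using F K by (blast intro: finite_int_subset_symmetric_interval[of "F \<union> K"])
  have "(\<Sum>n\<in>F. (hilbert_kernel_sum K a n)\<^sup>2) \<le> 12 * (\<Sum>k\<in>K. (a k)\<^sup>2) + \<epsilon> N" if "N \<ge> M" for N
  proof -
    let ?I = "{- int N..int N}"
    have sub: "F \<subseteq> ?I" "K \<subseteq> ?I"
      using M that by (force dest: subsetD)+
    have "(\<Sum>n\<in>F. (hilbert_kernel_sum K a n)\<^sup>2) \<le> (\<Sum>n\<in>?I. (hilbert_kernel_sum K a n)\<^sup>2)"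
      using sub by (intro sum_mono2) auto
    also have "\<dots> = \<epsilon> N + (\<Sum>n\<in>?I. square_kernel_sum K (\<lambda>k. (a k)\<^sup>2) n)
        + 2 * (\<Sum>n\<in>?I. a n * square_kernel_sum K a n)"
      by (subst hilbert_kernel_sum_power2[OF K a])
        (auto simp: \<epsilon>_def b_def[abs_def] sum.distrib sum_distrib_left)
    also have "(\<Sum>n\<in>?I. a n * square_kernel_sum K a n) = (\<Sum>n\<in>K. a n * square_kernel_sum K a n)"
      using sub a by (intro sum.mono_neutral_right) auto
    also have "\<epsilon> N + (\<Sum>n\<in>?I. square_kernel_sum K (\<lambda>k. (a k)\<^sup>2) n) + 2 * \<dots> \<le> 12 * (\<Sum>k\<in>K. (a k)\<^sup>2) + \<epsilon> N"
      using sum_square_kernel_sum_le[of ?I K "\<lambda>k. (a k)\<^sup>2"] sum_mult_square_kernel_sum_le[OF K, of a] K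
      by simp
    finally show ?thesis .
  qed
  then show ?thesis by (intro LIMSEQ_le_const[OF lim]) auto
qed

lemma power2_sum3_le: "(x + y + z)\<^sup>2 \<le> 3 * (x\<^sup>2 + y\<^sup>2 + z\<^sup>2)" for x y z :: real
proof -
  have "0 \<le> (x - y)\<^sup>2 + (y - z)\<^sup>2 + (z - x)\<^sup>2" by simp
  then show ?thesis by (simp add: power2_eq_square algebra_simps)
qed

text \<open>The case \<open>p = 4\<close> of M. Riesz's theorem. Squaring Cotlar's identity and summing bounds
\<open>X = \<Sum>(h a)\<^sup>4\<close> by a multiple of \<open>A = \<Sum>a\<^sup>4\<close> plus a multiple of
\<open>\<Sum>(h (a * h a))\<^sup>2\<close>. By Hilbert's inequality the latter is controlled by
\<open>\<Sum>a\<^sup>2 * (h a)\<^sup>2\<close>, and Young's inequality splits this into a multiple of \<open>A\<close> and a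
small multiple of \<open>X\<close>, which is absorbed on the left.\<close>

lemma sum_hilbert_kernel_sum_power4_le:
  assumes F: "finite F" and K: "finite K" and a: "\<And>k. k \<notin> K \<Longrightarrow> a k = 0"
  shows "(\<Sum>n\<in>F. (hilbert_kernel_sum K a n) ^ 4) \<le> 24000 * (\<Sum>k\<in>K. (a k) ^ 4)"
proof -
  let ?h = "hilbert_kernel_sum K a" and ?Q = "square_kernel_sum K a"
    and ?Q2 = "square_kernel_sum K (\<lambda>k. (a k)\<^sup>2)"
  define b where "b k = a k * ?h k" for k
  let ?hb = "hilbert_kernel_sum K b"
  \<comment> \<open>The absorption needs the sum defining \<open>X\<close> to include all of \<open>K\<close>.\<close>
  define G where "G = F \<union> K"
  have G: "finite G" "F \<subseteq> G" "K \<subseteq> G" using F K by (auto simp: G_def)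
  define A where "A = (\<Sum>k\<in>K. (a k) ^ 4)"
  define X where "X = (\<Sum>n\<in>G. (?h n) ^ 4)"
  have pointwise: "(?h n) ^ 4 \<le> 12 * (?hb n)\<^sup>2 + 3 * (?Q2 n)\<^sup>2 + 6 * ((a n) ^ 4 + (?Q n) ^ 4)" for n
  proof -
    have "(?h n) ^ 4 = ((?h n)\<^sup>2)\<^sup>2" by simp
    also have "\<dots> = (2 * ?hb n + ?Q2 n + 2 * (a n * ?Q n))\<^sup>2"
      by (subst hilbert_kernel_sum_power2[OF K a]) (simp_all add: b_def[abs_def])
    also have "\<dots> \<le> 3 * ((2 * ?hb n)\<^sup>2 + (?Q2 n)\<^sup>2 + (2 * (a n * ?Q n))\<^sup>2)"
      by (rule power2_sum3_le)
    also have "\<dots> = 12 * (?hb n)\<^sup>2 + 3 * (?Q2 n)\<^sup>2 + 6 * (2 * (a n)\<^sup>2 * (?Q n)\<^sup>2)"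
      by (simp add: power_mult_distrib)
    also have "2 * (a n)\<^sup>2 * (?Q n)\<^sup>2 \<le> (a n) ^ 4 + (?Q n) ^ 4"
      using sum_squares_bound[of "(a n)\<^sup>2" "(?Q n)\<^sup>2"] by (simp flip: power_mult)
    finally show ?thesis by simp
  qed
  have "X \<le> (\<Sum>n\<in>G. 12 * (?hb n)\<^sup>2 + 3 * (?Q2 n)\<^sup>2 + 6 * ((a n) ^ 4 + (?Q n) ^ 4))"
    unfolding X_def by (rule sum_mono) (rule pointwise)
  also have "\<dots> = 12 * (\<Sum>n\<in>G. (?hb n)\<^sup>2) + 3 * (\<Sum>n\<in>G. (?Q2 n)\<^sup>2)
      + 6 * ((\<Sum>n\<in>G. (a n) ^ 4) + (\<Sum>n\<in>G. (?Q n) ^ 4))"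
    by (simp add: sum.distrib sum_distrib_left)
  also have "(\<Sum>n\<in>G. (a n) ^ 4) = A"
    unfolding A_def using G a by (intro sum.mono_neutral_right) auto
  also have "(\<Sum>n\<in>G. (?Q n) ^ 4) \<le> 256 * A"
    unfolding A_def by (intro sum_square_kernel_sum_power4_le G K)
  also have "(\<Sum>n\<in>G. (?Q2 n)\<^sup>2) \<le> 16 * A"
    using sum_square_kernel_sum_power2_le[OF G(1) K, of "\<lambda>k. (a k)\<^sup>2"]
    by (simp add: A_def flip: power_mult)
  also have "(\<Sum>n\<in>G. (?hb n)\<^sup>2) \<le> 12 * (\<Sum>k\<in>K. (b k)\<^sup>2)"
    using a by (intro sum_hilbert_kernel_sum_power2_le G K) (auto simp: b_def)
  \<comment> \<open>The weight is chosen because \<open>12 * 12 / 288 = 1 / 2\<close>, so that half of \<open>X\<close> is absorbed.\<close>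
  also have "(\<Sum>k\<in>K. (b k)\<^sup>2) \<le> 72 * A + X / 288"
  proof -
    have "(b k)\<^sup>2 \<le> 72 * (a k) ^ 4 + (?h k) ^ 4 / 288" for k
      using sum_squares_bound[of "12 * (a k)\<^sup>2" "(?h k)\<^sup>2 / 12"]
      by (simp add: b_def power_mult_distrib power_divide flip: power_mult)
    then have "(\<Sum>k\<in>K. (b k)\<^sup>2) \<le> (\<Sum>k\<in>K. 72 * (a k) ^ 4 + (?h k) ^ 4 / 288)"
      by (rule sum_mono)
    also have "\<dots> = 72 * A + (\<Sum>k\<in>K. (?h k) ^ 4) / 288"
      by (simp add: A_def sum.distrib sum_distrib_left sum_divide_distrib)
    also have "(\<Sum>k\<in>K. (?h k) ^ 4) \<le> X"
      unfolding X_def using G by (intro sum_mono2) auto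
    finally show ?thesis by simp
  qed
  finally have "X \<le> 11958 * A + X / 2"
    by (simp add: algebra_simps)
  moreover have "0 \<le> A" unfolding A_def by (intro sum_nonneg) auto
  ultimately have "X \<le> 24000 * A" by simp
  moreover have "(\<Sum>n\<in>F. (?h n) ^ 4) \<le> X"
    unfolding X_def using G by (intro sum_mono2) auto
  ultimately show ?thesis by (simp add: A_def)
qed

section \<open>The sequence space for exponent 4\<close>

lemma mem_ell_4: "x \<in> ell 4 \<longleftrightarrow> (\<lambda>j. norm (x j) ^ 4) summable_on UNIV"
  by (simp add: ell_def powr_numeral)

lemma ell_norm_nonneg: "0 \<le> ell_norm p x"
  by (simp add: ell_norm_def)

lemma ell_norm_4_power4: "ell_norm 4 x ^ 4 = (\<Sum>\<^sub>\<infinity>j. norm (x j) ^ 4)"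
proof -
  have "0 \<le> (\<Sum>\<^sub>\<infinity>j. norm (x j) ^ 4)" by (rule infsum_nonneg) simp
  then have "((\<Sum>\<^sub>\<infinity>j. norm (x j) ^ 4) powr (1 / 4)) powr 4 = (\<Sum>\<^sub>\<infinity>j. norm (x j) ^ 4)"
    by (simp only: powr_powr) simp
  then show ?thesis by (simp add: ell_norm_def powr_numeral)
qed

lemma norm_le_ell_norm_4:
  assumes "x \<in> ell 4"
  shows "norm (x n) \<le> ell_norm 4 x"
proof -
  have "(\<Sum>j\<in>{n}. norm (x j) ^ 4) \<le> (\<Sum>\<^sub>\<infinity>j. norm (x j) ^ 4)"
    using assms unfolding mem_ell_4 by (intro finite_sum_le_infsum) auto
  then have "norm (x n) ^ 4 \<le> ell_norm 4 x ^ 4" by (simp add: ell_norm_4_power4)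
  then show ?thesis by (rule power_le_imp_le_base[of _ 3, simplified]) (rule ell_norm_nonneg)
qed

lemma power4_sum2_le: "(a + b) ^ 4 \<le> 8 * (a ^ 4 + b ^ 4)" for a b :: real
proof -
  have *: "(x + y)\<^sup>2 \<le> 2 * (x\<^sup>2 + y\<^sup>2)" for x y :: real
    using sum_squares_bound[of x y] by (simp add: power2_sum)
  have "((a + b)\<^sup>2)\<^sup>2 \<le> (2 * (a\<^sup>2 + b\<^sup>2))\<^sup>2"
    using * by (intro power_mono) auto
  also have "\<dots> = 4 * (a\<^sup>2 + b\<^sup>2)\<^sup>2" by (subst power_mult_distrib) simp
  also have "\<dots> \<le> 4 * (2 * ((a\<^sup>2)\<^sup>2 + (b\<^sup>2)\<^sup>2))"
    by (intro mult_left_mono *) auto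
  finally show ?thesis by simp
qed

lemma ell_4_add:
  assumes "x \<in> ell 4" "y \<in> ell 4"
  shows "(\<lambda>j. x j + y j) \<in> ell 4"
  unfolding mem_ell_4
proof (rule summable_on_comparison_test)
  show "(\<lambda>j. 8 * (norm (x j) ^ 4 + norm (y j) ^ 4)) summable_on UNIV"
    using assms unfolding mem_ell_4 by (intro summable_on_cmult_right summable_on_add)
  show "norm (x j + y j) ^ 4 \<le> 8 * (norm (x j) ^ 4 + norm (y j) ^ 4)" for j
    by (rule order_trans[OF power_mono[OF norm_triangle_ineq] power4_sum2_le]) auto
qed auto

lemma ell_4_cmult:
  assumes "x \<in> ell 4"
  shows "(\<lambda>j. c * x j) \<in> ell 4"
  using assms unfolding mem_ell_4
  by (simp add: norm_mult power_mult_distrib summable_on_cmult_right)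

lemma finitely_supported_in_ell_4:
  assumes "finitely_supported x"
  shows "x \<in> ell 4"
proof -
  have "(\<lambda>j. norm (x j) ^ 4) summable_on {j. x j \<noteq> 0}"
    using assms by (intro summable_on_finite) (simp add: finitely_supported_def)
  then show ?thesis unfolding mem_ell_4
    by (subst (asm) summable_on_cong_neutral[where g = "\<lambda>j. norm (x j) ^ 4" and T = UNIV]) auto
qed

section \<open>The transform as a bounded operator\<close>

text \<open>As \<open>1 / 0 = 0\<close>, the summation can run over all integers, which makes the transform a
matrix with the same index set on both sides.\<close>

lemma hilbert_sum_eq_infsum_kernel:
  "hilbert_sum x n = complex_of_real (1 / pi) * (\<Sum>\<^sub>\<infinity>k. x k / of_int (n - k))"
proof -
  have "(\<Sum>\<^sub>\<infinity>m\<in>UNIV - {0}. x (n - m) / of_int m) = (\<Sum>\<^sub>\<infinity>m. x (n - m) / of_int m)"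
    by (rule infsum_cong_neutral) auto
  also have "\<dots> = (\<Sum>\<^sub>\<infinity>k. x k / of_int (n - k))"
    by (rule infsum_reindex_bij_witness[of _ "\<lambda>k. n - k" "\<lambda>m. n - m"]) auto
  finally show ?thesis by (simp add: hilbert_sum_def)
qed

lemma sum_norm_complex_kernel_sum_power4_le:
  fixes x :: "int \<Rightarrow> complex"
  assumes F: "finite F" and K: "finite K"
  shows "(\<Sum>n\<in>F. norm (\<Sum>k\<in>K. x k / of_int (n - k)) ^ 4) \<le> 96000 * (\<Sum>k\<in>K. norm (x k) ^ 4)"
proof -
  define a b where "a k = (if k \<in> K then Re (x k) else 0)"
    and "b k = (if k \<in> K then Im (x k) else 0)" for k
  have parts: "Re (z / of_int m) = Re z / of_int m" "Im (z / of_int m) = Im z / of_int m" for z m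
    using Re_divide_of_real[of z "of_int m"] Im_divide_of_real[of z "of_int m"] by simp_all
  have Re: "Re (\<Sum>k\<in>K. x k / of_int (n - k)) = hilbert_kernel_sum K a n" for n
    unfolding hilbert_kernel_sum_def Re_sum
    by (intro sum.cong) (auto simp: a_def parts simp flip: of_int_diff)
  have Im: "Im (\<Sum>k\<in>K. x k / of_int (n - k)) = hilbert_kernel_sum K b n" for n
    unfolding hilbert_kernel_sum_def Im_sum
    by (intro sum.cong) (auto simp: b_def parts simp flip: of_int_diff)
  have "norm z ^ 4 \<le> 2 * ((Re z) ^ 4 + (Im z) ^ 4)" for z
  proof -
    have "norm z ^ 4 = ((norm z)\<^sup>2)\<^sup>2" by simp
    also have "\<dots> = ((Re z)\<^sup>2 + (Im z)\<^sup>2)\<^sup>2" by (simp only: cmod_power2)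
    also have "\<dots> \<le> 2 * ((Re z) ^ 4 + (Im z) ^ 4)"
      using sum_squares_bound[of "(Re z)\<^sup>2" "(Im z)\<^sup>2"] by (simp add: power2_sum)
    finally show ?thesis .
  qed
  then have "(\<Sum>n\<in>F. norm (\<Sum>k\<in>K. x k / of_int (n - k)) ^ 4)
      \<le> (\<Sum>n\<in>F. 2 * (hilbert_kernel_sum K a n ^ 4 + hilbert_kernel_sum K b n ^ 4))"
    unfolding Re[symmetric] Im[symmetric] by (intro sum_mono) blast
  also have "\<dots> = 2 * ((\<Sum>n\<in>F. hilbert_kernel_sum K a n ^ 4) + (\<Sum>n\<in>F. hilbert_kernel_sum K b n ^ 4))"
    by (simp add: sum.distrib sum_distrib_left)
  also have "\<dots> \<le> 2 * (24000 * (\<Sum>k\<in>K. (a k) ^ 4) + 24000 * (\<Sum>k\<in>K. (b k) ^ 4))"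
    by (intro mult_left_mono add_mono sum_hilbert_kernel_sum_power4_le assms) (auto simp: a_def b_def)
  also have "\<dots> \<le> 2 * (24000 * (\<Sum>k\<in>K. norm (x k) ^ 4) + 24000 * (\<Sum>k\<in>K. norm (x k) ^ 4))"
  proof -
    have "(Re z) ^ 4 \<le> norm z ^ 4" "(Im z) ^ 4 \<le> norm z ^ 4" for z
      using power_mono[OF abs_Re_le_cmod[of z], of 4] power_mono[OF abs_Im_le_cmod[of z], of 4] by auto
    then show ?thesis
      by (intro mult_left_mono add_mono sum_mono) (auto simp: a_def b_def)
  qed
  finally show ?thesis by simp
qed

text \<open>Young's inequality with constants rounded up; it replaces Hoelder's inequality for the duality of
\<open>\<ell>\<^sub>4\<close> and \<open>\<ell>\<^bsub>4/3\<^esub>\<close> throughout.\<close>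

lemma Young_4:
  fixes u v :: real
  assumes "0 \<le> u" "0 \<le> v"
  shows "u * v \<le> u ^ 4 + v powr (4/3)"
proof -
  have "u * v \<le> u powr 4 / 4 + v powr (4/3) / (4/3)"
    using assms by (intro Youngs_inequality) auto
  also have "u powr 4 = u ^ 4" using assms by (simp add: powr_numeral)
  also have "u ^ 4 / 4 + v powr (4/3) / (4/3) \<le> u ^ 4 + v powr (4/3)"
    using assms by (intro add_mono) auto
  finally show ?thesis .
qed

lemma norm_mult_summable_on:
  assumes "x \<in> ell 4" "y \<in> ell (4/3)"
  shows "(\<lambda>j. norm (x j * y j)) summable_on UNIV"
proof (rule summable_on_comparison_test)
  show "(\<lambda>j. norm (x j) ^ 4 + norm (y j) powr (4/3)) summable_on UNIV"
    using assms unfolding mem_ell_4 by (intro summable_on_add) (auto simp: ell_def)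
  show "norm (x j * y j) \<le> norm (x j) ^ 4 + norm (y j) powr (4/3)" for j
    unfolding norm_mult by (rule Young_4) auto
qed auto

lemma hilbert_kernel_in_ell:
  assumes "p > 1"
  shows "(\<lambda>k. 1 / of_int (n - k)) \<in> ell p"
proof -
  let ?f = "\<lambda>m::int. (1 / \<bar>real_of_int m\<bar>) powr p"
  have "(\<lambda>i. (1 / real i) powr p) summable_on UNIV"
  proof -
    have "summable (\<lambda>i. real i powr (- p))" using assms by (simp add: summable_real_powr_iff)
    moreover have "(1 / real i) powr p = real i powr (- p)" for i
      by (simp add: powr_divide powr_minus_divide)
    ultimately show ?thesis
      by (subst summable_on_UNIV_nonneg_real_iff) auto
  qed
  then have "?f summable_on range int" "?f summable_on range (\<lambda>i. - int i)"
    by (subst summable_on_reindex; simp add: inj_on_def o_def)+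
  then have "?f summable_on (range int \<union> range (\<lambda>i. - int i))"
    by (rule summable_on_union)
  also have "range int \<union> range (\<lambda>i. - int i) = UNIV"
    by (auto simp: image_iff) (metis int_cases2)
  finally have "(\<lambda>k. ?f (n - k)) summable_on UNIV"
    by (subst summable_on_reindex_bij_betw[of "\<lambda>k. n - k" UNIV UNIV ?f])
      (auto intro!: bij_betwI[of _ _ _ "\<lambda>k. n - k"])
  then show ?thesis
    by (simp add: ell_def norm_divide flip: of_int_diff)
qed

lemma kernel_abs_summable_on:
  assumes "x \<in> ell 4"
  shows "(\<lambda>k. norm (x k / of_int (n - k))) summable_on UNIV"
  using norm_mult_summable_on[OF assms hilbert_kernel_in_ell, of n] by simp

text \<open>By absolute convergence, \<open>hilbert_sum x n\<close> is the limit of the sums over finite sets \<open>K\<close>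
of indices, and the bound for these is uniform in \<open>K\<close> and \<open>F\<close>.\<close>

lemma sum_norm_hilbert_sum_power4_le:
  assumes x: "x \<in> ell 4" and F: "finite F"
  shows "(\<Sum>n\<in>F. norm (hilbert_sum x n) ^ 4) \<le> 96000 * ell_norm 4 x ^ 4"
proof -
  let ?g = "\<lambda>K n. complex_of_real (1 / pi) * (\<Sum>k\<in>K. x k / of_int (n - k))"
  have "(\<lambda>k. x k / of_int (n - k)) summable_on UNIV" for n
    using kernel_abs_summable_on[OF x] by (rule abs_summable_summable)
  then have "((\<lambda>K. \<Sum>n\<in>F. norm (?g K n) ^ 4) \<longlongrightarrow> (\<Sum>n\<in>F. norm (hilbert_sum x n) ^ 4))
      (finite_subsets_at_top UNIV)"
    unfolding hilbert_sum_eq_infsum_kernel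
    by (intro tendsto_sum tendsto_power tendsto_norm tendsto_mult tendsto_const infsum_tendsto)
  moreover have "(\<Sum>n\<in>F. norm (?g K n) ^ 4) \<le> 96000 * ell_norm 4 x ^ 4" if K: "finite K" for K
  proof -
    have "norm (?g K n) ^ 4 \<le> norm (\<Sum>k\<in>K. x k / of_int (n - k)) ^ 4" for n
    proof -
      have "1 / pi \<le> 1" using pi_gt3 by simp
      then have "1 / pi * norm (\<Sum>k\<in>K. x k / of_int (n - k)) \<le> 1 * norm (\<Sum>k\<in>K. x k / of_int (n - k))"
        by (intro mult_right_mono) auto
      then show ?thesis by (intro power_mono) (auto simp: norm_mult norm_divide)
    qed
    then have "(\<Sum>n\<in>F. norm (?g K n) ^ 4) \<le> (\<Sum>n\<in>F. norm (\<Sum>k\<in>K. x k / of_int (n - k)) ^ 4)"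
      by (rule sum_mono)
    also have "\<dots> \<le> 96000 * (\<Sum>k\<in>K. norm (x k) ^ 4)"
      by (rule sum_norm_complex_kernel_sum_power4_le[OF F K])
    also have "\<dots> \<le> 96000 * ell_norm 4 x ^ 4"
      unfolding ell_norm_4_power4 using x K unfolding mem_ell_4
      by (intro mult_left_mono finite_sum_le_infsum) auto
    finally show ?thesis .
  qed
  then have "eventually (\<lambda>K. (\<Sum>n\<in>F. norm (?g K n) ^ 4) \<le> 96000 * ell_norm 4 x ^ 4)
      (finite_subsets_at_top UNIV)"
    by (rule eventually_finite_subsets_at_top_weakI)
  ultimately show ?thesis
    by (rule tendsto_upperbound) simp
qed

lemma hilbert_sum_in_ell_4:
  assumes x: "x \<in> ell 4"
  shows "hilbert_sum x \<in> ell 4"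
  unfolding mem_ell_4
  by (rule nonneg_bdd_above_summable_on)
    (auto intro!: bdd_aboveI2 sum_norm_hilbert_sum_power4_le[OF x])

lemma ell_norm_hilbert_sum_le:
  assumes x: "x \<in> ell 4"
  shows "ell_norm 4 (hilbert_sum x) \<le> 20 * ell_norm 4 x"
proof -
  have "ell_norm 4 (hilbert_sum x) ^ 4 \<le> 96000 * ell_norm 4 x ^ 4"
    unfolding ell_norm_4_power4[of "hilbert_sum x"]
    using hilbert_sum_in_ell_4[OF x] unfolding mem_ell_4
    by (rule infsum_le_finite_sums) (rule sum_norm_hilbert_sum_power4_le[OF x])
  also have "\<dots> \<le> 160000 * ell_norm 4 x ^ 4" by (intro mult_right_mono) auto
  also have "\<dots> = (20 * ell_norm 4 x) ^ 4" by (simp add: power_mult_distrib)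
  finally show ?thesis
    by (rule power_le_imp_le_base[of _ 3, simplified]) (simp add: ell_norm_nonneg)
qed

lemma bounded_operator_hilbert_sum: "bounded_operator 4 (restrict hilbert_sum (ell 4))"
  unfolding bounded_operator_def
proof (intro conjI ballI allI)
  show "restrict hilbert_sum (ell 4) \<in> ell 4 \<rightarrow>\<^sub>E ell 4"
    by (auto simp: hilbert_sum_in_ell_4)
  show "\<exists>C. \<forall>x\<in>ell 4. ell_norm 4 (restrict hilbert_sum (ell 4) x) \<le> C * ell_norm 4 x"
    using ell_norm_hilbert_sum_le by (intro exI[of _ 20]) auto
next
  fix x y assume xy: "x \<in> ell 4" "y \<in> ell 4"
  note summ = kernel_abs_summable_on[THEN abs_summable_summable]
  have "hilbert_sum (\<lambda>j. x j + y j) n = hilbert_sum x n + hilbert_sum y n" for n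
    unfolding hilbert_sum_eq_infsum_kernel add_divide_distrib
    by (subst infsum_add) (auto intro: summ xy simp del: of_int_diff simp: algebra_simps)
  then show "restrict hilbert_sum (ell 4) (\<lambda>j. x j + y j) =
      (\<lambda>j. restrict hilbert_sum (ell 4) x j + restrict hilbert_sum (ell 4) y j)"
    using xy by (auto simp: ell_4_add)
next
  fix c x assume x: "x \<in> ell 4"
  have "hilbert_sum (\<lambda>j. c * x j) n = c * hilbert_sum x n" for n
    unfolding hilbert_sum_eq_infsum_kernel
    by (subst times_divide_eq_right[symmetric], subst infsum_cmult_right') simp
  then show "restrict hilbert_sum (ell 4) (\<lambda>j. c * x j) = (\<lambda>j. c * restrict hilbert_sum (ell 4) x j)"
    using x by (auto simp: ell_4_cmult)
qed

lemma bounded_operator_norm_power4_le: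
  assumes "bounded_operator 4 T"
  obtains C where "\<And>x n. x \<in> ell 4 \<Longrightarrow> norm (T x n) ^ 4 \<le> C * ell_norm 4 x ^ 4"
proof -
  obtain C where C: "\<And>x. x \<in> ell 4 \<Longrightarrow> ell_norm 4 (T x) \<le> C * ell_norm 4 x"
    and T: "\<And>x. x \<in> ell 4 \<Longrightarrow> T x \<in> ell 4"
    using assms unfolding bounded_operator_def by blast
  have "norm (T x n) ^ 4 \<le> (C * ell_norm 4 x) ^ 4" if "x \<in> ell 4" for x n
    using norm_le_ell_norm_4[OF T[OF that], of n] C[OF that] by (intro power_mono) auto
  then show ?thesis by (intro that[of "C ^ 4"]) (simp add: power_mult_distrib)
qed

text \<open>Density of the finitely supported sequences. Splitting \<open>x\<close> into its restriction to a finite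
set \<open>K\<close> and the tail, \<open>S x - T x\<close> depends only on the tail, whose norm tends to zero.
Outside \<open>ell 4\<close> both operators are undefined.\<close>

lemma bounded_operator_eqI:
  assumes S: "bounded_operator 4 S" and T: "bounded_operator 4 T"
    and eq: "\<And>a. finitely_supported a \<Longrightarrow> S a = T a"
  shows "S = T"
proof
  fix x
  show "S x = T x"
  proof (cases "x \<in> ell 4")
    case False
    then show ?thesis using S T unfolding bounded_operator_def by (metis PiE_arb)
  next
    case x: True
    obtain C where C: "\<And>x n. x \<in> ell 4 \<Longrightarrow> norm (S x n) ^ 4 \<le> C * ell_norm 4 x ^ 4"
      using bounded_operator_norm_power4_le[OF S] by blast
    obtain D where D: "\<And>x n. x \<in> ell 4 \<Longrightarrow> norm (T x n) ^ 4 \<le> D * ell_norm 4 x ^ 4"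
      using bounded_operator_norm_power4_le[OF T] by blast
    let ?f = "\<lambda>j. norm (x j) ^ 4"
    have f: "?f summable_on UNIV" using x by (simp add: mem_ell_4)
    show ?thesis
    proof
      fix n
      have bound: "norm (S x n - T x n) ^ 4 \<le> 8 * (C + D) * (infsum ?f UNIV - sum ?f K)" if K: "finite K" for K
      proof -
        define u v where "u j = (if j \<in> K then x j else 0)" and "v j = (if j \<in> K then 0 else x j)" for j
        have u: "finitely_supported u"
          using K by (auto simp: finitely_supported_def u_def intro: finite_subset[of _ K])
        note u_ell = finitely_supported_in_ell_4[OF u]
        have "v = (\<lambda>j. x j + (-1) * u j)" by (auto simp: u_def v_def)
        then have v: "v \<in> ell 4" using ell_4_add[OF x ell_4_cmult[OF u_ell, of "-1"]] by simp
        have xuv: "x = (\<lambda>j. u j + v j)" by (auto simp: u_def v_def)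
        have "S (\<lambda>j. u j + v j) = (\<lambda>j. S u j + S v j)" "T (\<lambda>j. u j + v j) = (\<lambda>j. T u j + T v j)"
          using S T u_ell v unfolding bounded_operator_def by blast+
        then have "S x n = S u n + S v n" "T x n = T u n + T v n"
          by (simp_all flip: xuv)
        then have "norm (S x n - T x n) = norm (S v n - T v n)"
          using eq[OF u] by simp
        also have "\<dots> ^ 4 \<le> (norm (S v n) + norm (T v n)) ^ 4"
          by (intro power_mono norm_triangle_ineq4) auto
        also have "\<dots> \<le> 8 * (norm (S v n) ^ 4 + norm (T v n) ^ 4)" by (rule power4_sum2_le)
        also have "\<dots> \<le> 8 * (C * ell_norm 4 v ^ 4 + D * ell_norm 4 v ^ 4)"
          using C[OF v] D[OF v] by (intro mult_left_mono add_mono) auto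
        also have "ell_norm 4 v ^ 4 = infsum ?f (UNIV - K)"
          unfolding ell_norm_4_power4 by (rule infsum_cong_neutral) (auto simp: v_def)
        also have "\<dots> = infsum ?f UNIV - sum ?f K"
          using f K by (subst infsum_Diff) auto
        finally show ?thesis by (simp add: algebra_simps)
      qed
      have "((\<lambda>K. 8 * (C + D) * (infsum ?f UNIV - sum ?f K)) \<longlongrightarrow>
          8 * (C + D) * (infsum ?f UNIV - infsum ?f UNIV)) (finite_subsets_at_top UNIV)"
        by (intro tendsto_mult tendsto_diff tendsto_const infsum_tendsto f)
      then have "norm (S x n - T x n) ^ 4 \<le> 8 * (C + D) * (infsum ?f UNIV - infsum ?f UNIV)"
        by (rule tendsto_lowerbound) (simp_all only: eventually_finite_subsets_at_top_weakI bound
            finite_subsets_at_top_neq_bot not_False_eq_True)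
      then show "S x n = T x n" by simp
    qed
  qed
qed

text \<open>The series defining \<open>hilbert_sum\<close> converges on all of \<open>ell 4\<close> and gives a bounded
operator there; by uniqueness this operator is the extension.\<close>

lemma discrete_hilbert_transform_4: "discrete_hilbert_transform 4 = restrict hilbert_sum (ell 4)"
  unfolding discrete_hilbert_transform_def
proof (rule the_equality)
  show "bounded_operator 4 (restrict hilbert_sum (ell 4)) \<and>
      (\<forall>a. finitely_supported a \<longrightarrow> restrict hilbert_sum (ell 4) a = hilbert_sum a)"
    using bounded_operator_hilbert_sum finitely_supported_in_ell_4 by auto
  then show "T = restrict hilbert_sum (ell 4)"
    if "bounded_operator 4 T \<and> (\<forall>a. finitely_supported a \<longrightarrow> T a = hilbert_sum a)" for T
    using that by (intro bounded_operator_eqI) auto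
qed

section \<open>Translations and weakly null sequences\<close>

lemma infsum_tail_less:
  fixes f :: "'a \<Rightarrow> real"
  assumes f: "f summable_on UNIV" and "\<epsilon> > 0"
  obtains K where "finite K" "infsum f (- K) < \<epsilon>"
proof -
  obtain K where K: "finite K" "dist (sum f K) (infsum f UNIV) < \<epsilon>"
    using tendstoD[OF infsum_tendsto[OF f] \<open>\<epsilon> > 0\<close>]
    by (auto simp: eventually_finite_subsets_at_top)
  have "infsum f (- K) = infsum f UNIV - sum f K"
    using infsum_Diff[OF f, of K] K by (simp add: Compl_eq_Diff_UNIV)
  then show ?thesis using that[OF K(1)] K(2) by (simp add: dist_real_def)
qed

text \<open>For \<open>y\<close> in the dual space, the pairing over a finite set \<open>K\<close> tends to zero by
hypothesis, and on the complement of \<open>K\<close> Young's inequality applied to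
\<open>\<delta> * norm (X k j)\<close> and \<open>norm (y j) / \<delta>\<close> bounds it by \<open>\<delta> ^ 4\<close> plus a multiple of
the tail of \<open>y\<close>. First \<open>\<delta>\<close> is made small, then \<open>K\<close> is chosen depending on
\<open>\<delta>\<close>.\<close>

lemma weakly_null_if_coordinatewise_null:
  assumes X: "\<And>k. X k \<in> ell 4" "\<And>k. ell_norm 4 (X k) = 1"
    and null: "\<And>j. (\<lambda>k. X k j) \<longlonglongrightarrow> 0"
  shows "weakly_null X"
  unfolding weakly_null_def
proof (intro ballI tendstoI)
  fix y and \<epsilon> :: real assume y: "y \<in> ell (4/3)" and "\<epsilon> > 0"
  define \<delta> where "\<delta> = min 1 (\<epsilon> / 3)"
  have \<delta>: "0 < \<delta>" "\<delta> \<le> 1" "\<delta> \<le> \<epsilon> / 3" using \<open>\<epsilon> > 0\<close> by (auto simp: \<delta>_def)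
  let ?g = "\<lambda>j. norm (y j) powr (4/3)"
  have g: "?g summable_on UNIV" using y by (simp add: ell_def)
  obtain K where K: "finite K" "infsum ?g (- K) < \<epsilon> / 3 * \<delta> powr (4/3)"
    using infsum_tail_less[OF g, of "\<epsilon> / 3 * \<delta> powr (4/3)"] \<delta> by auto
  have "(\<lambda>k. \<Sum>j\<in>K. X k j * cnj (y j)) \<longlonglongrightarrow> (\<Sum>j\<in>K. 0 * cnj (y j))"
    by (intro tendsto_sum tendsto_mult null tendsto_const)
  then have "eventually (\<lambda>k. norm (\<Sum>j\<in>K. X k j * cnj (y j)) < \<epsilon> / 3) sequentially"
    using tendstoD[of _ _ sequentially "\<epsilon> / 3"] \<open>\<epsilon> > 0\<close> by fastforce
  then show "eventually (\<lambda>k. dist (pairing (X k) y) 0 < \<epsilon>) sequentially"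
  proof eventually_elim
    case (elim k)
    let ?f = "\<lambda>j. norm (X k j) ^ 4"
    have f: "?f summable_on UNIV" using X by (simp add: mem_ell_4)
    have "(\<lambda>j. cnj (y j)) \<in> ell (4/3)" using y by (simp add: ell_def)
    then have abs: "(\<lambda>j. norm (X k j * cnj (y j))) summable_on UNIV"
      by (rule norm_mult_summable_on[OF X(1)])
    have summ: "(\<lambda>j. X k j * cnj (y j)) summable_on UNIV"
      using abs by (rule abs_summable_summable)
    have "pairing (X k) y - (\<Sum>j\<in>K. X k j * cnj (y j)) = (\<Sum>\<^sub>\<infinity>j\<in>-K. X k j * cnj (y j))"
      using infsum_Diff[OF summ, of K] K by (simp add: Compl_eq_Diff_UNIV pairing_def)
    moreover have "norm (\<Sum>\<^sub>\<infinity>j\<in>-K. X k j * cnj (y j)) \<le> (\<Sum>\<^sub>\<infinity>j\<in>-K. norm (X k j * cnj (y j)))"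
      using summable_on_subset_banach[OF abs, of "- K"] by (intro norm_infsum_bound) auto
    moreover have "\<dots> \<le> (\<Sum>\<^sub>\<infinity>j\<in>-K. \<delta> ^ 4 * ?f j + (1 / \<delta>) powr (4/3) * ?g j)"
    proof (rule infsum_mono)
      show "(\<lambda>j. norm (X k j * cnj (y j))) summable_on - K"
        using summable_on_subset_banach[OF abs, of "- K"] by auto
      show "(\<lambda>j. \<delta> ^ 4 * ?f j + (1 / \<delta>) powr (4/3) * ?g j) summable_on - K"
        using f g by (intro summable_on_add summable_on_cmult_right)
          (auto intro: summable_on_subset_banach)
      fix j
      show "norm (X k j * cnj (y j)) \<le> \<delta> ^ 4 * ?f j + (1 / \<delta>) powr (4/3) * ?g j"
        using Young_4[of "\<delta> * norm (X k j)" "1 / \<delta> * norm (y j)"] \<delta>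
        by (simp add: norm_mult power_mult_distrib powr_mult powr_divide)
    qed
    moreover have "\<dots> = \<delta> ^ 4 * infsum ?f (- K) + (1 / \<delta>) powr (4/3) * infsum ?g (- K)"
      using f g by (subst infsum_add)
        (auto intro!: summable_on_cmult_right simp: infsum_cmult_right' intro: summable_on_subset_banach)
    moreover have "\<delta> ^ 4 * infsum ?f (- K) \<le> \<epsilon> / 3"
    proof -
      have "infsum ?f (- K) \<le> infsum ?f UNIV"
        using f by (intro infsum_mono_neutral) (auto intro: summable_on_subset_banach)
      also have "\<dots> = 1" using X by (simp flip: ell_norm_4_power4)
      finally have "infsum ?f (- K) \<le> 1" .
      moreover have "\<delta> ^ 4 \<le> \<delta>" using power_decreasing[of 1 4 \<delta>] \<delta> by simp
      moreover have "0 \<le> infsum ?f (- K)" by (rule infsum_nonneg) simp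
      ultimately have "\<delta> ^ 4 * infsum ?f (- K) \<le> \<delta> * 1"
        using \<delta> by (intro mult_mono) auto
      then show ?thesis using \<delta> by simp
    qed
    moreover have "(1 / \<delta>) powr (4/3) * infsum ?g (- K) < \<epsilon> / 3"
      using K(2) \<delta> by (simp add: powr_divide field_simps)
    ultimately have "norm (pairing (X k) y - (\<Sum>j\<in>K. X k j * cnj (y j))) < 2 * \<epsilon> / 3"
      by simp
    with elim show ?case
      using norm_triangle_sub[of "pairing (X k) y" "\<Sum>j\<in>K. X k j * cnj (y j)"] by simp
  qed
qed

definition shift :: "int \<Rightarrow> (int \<Rightarrow> complex) \<Rightarrow> (int \<Rightarrow> complex)" where
  "shift s x = (\<lambda>j. x (j - s))"

lemma bij_minus_int: "bij (\<lambda>j. j - s :: int)"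
  by (rule bij_betwI[of _ _ _ "\<lambda>j. j + s"]) auto

lemma shift_in_ell_4: "x \<in> ell 4 \<Longrightarrow> shift s x \<in> ell 4"
  unfolding mem_ell_4 shift_def
  using summable_on_reindex_bij_betw[OF bij_minus_int, of "\<lambda>j. norm (x j) ^ 4" s] by simp

lemma ell_norm_shift: "ell_norm p (shift s x) = ell_norm p x"
  unfolding ell_norm_def shift_def
  using infsum_reindex_bij_betw[OF bij_minus_int, of "\<lambda>j. norm (x j) powr p" s] by simp

lemma hilbert_sum_shift: "hilbert_sum (shift s x) = shift s (hilbert_sum x)"
  by (auto simp: hilbert_sum_def shift_def algebra_simps)

lemma pairing_shift: "pairing (shift s x) (shift s y) = pairing x y"
  unfolding pairing_def shift_def
  using infsum_reindex_bij_betw[OF bij_minus_int, of "\<lambda>j. x j * cnj (y j)" s] by simp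

lemma duality_map_shift: "duality_map (shift s x) = shift s (duality_map x)"
  by (simp add: duality_map_def shift_def)

text \<open>All but finitely many entries of \<open>x\<close> are small, and a translation carries the exceptional
ones outside any given interval.\<close>

lemma exists_shift_small_near_0:
  assumes x: "x \<in> ell 4" and "\<epsilon> > 0"
  obtains s where "\<And>j. \<bar>j\<bar> \<le> int k \<Longrightarrow> norm (shift s x j) < \<epsilon>"
proof -
  let ?f = "\<lambda>j. norm (x j) ^ 4"
  have f: "?f summable_on UNIV" using x by (simp add: mem_ell_4)
  obtain K where K: "finite K" "infsum ?f (- K) < \<epsilon> ^ 4"
    using infsum_tail_less[OF f, of "\<epsilon> ^ 4"] \<open>\<epsilon> > 0\<close> by auto
  have small: "norm (x j) < \<epsilon>" if "j \<notin> K" for j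
  proof -
    have "sum ?f {j} \<le> infsum ?f (- K)"
      using that f by (intro finite_sum_le_infsum) (auto intro: summable_on_subset_banach)
    with K have "norm (x j) ^ 4 < \<epsilon> ^ 4" by simp
    then show ?thesis by (rule power_less_imp_less_base) (use \<open>\<epsilon> > 0\<close> in simp)
  qed
  obtain m where m: "\<And>j. j \<in> K \<Longrightarrow> m \<le> j"
    using K(1) bdd_below_finite[of K] by (auto simp: bdd_below_def)
  have "j - (int k - m + 1) \<notin> K" if "\<bar>j\<bar> \<le> int k" for j
    using m[of "j - (int k - m + 1)"] that by auto
  then show ?thesis using that small by (metis shift_def)
qed

text \<open>A translation-invariant operator takes the same value on every translate of a unit vector.
So, given values \<open>w k\<close> tending to \<open>l\<close>, unit vectors attaining them can be translated
so far that they become coordinatewise null, hence weakly null, without changing the values.\<close>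

lemma closure_numerical_range_subset:
  assumes T: "\<And>x s. x \<in> ell 4 \<Longrightarrow> T (shift s x) = shift s (T x)"
  shows "closure (numerical_range T) \<subseteq> essential_numerical_range T"
proof
  fix l assume "l \<in> closure (numerical_range T)"
  then obtain w where w: "\<And>k. w k \<in> numerical_range T" and lim: "w \<longlonglongrightarrow> l"
    unfolding closure_sequential by blast
  have "\<exists>X. X \<in> ell 4 \<and> ell_norm 4 X = 1 \<and> pairing (T X) (duality_map X) = w k \<and>
      (\<forall>j. \<bar>j\<bar> \<le> int k \<longrightarrow> norm (X j) < 1 / real (Suc k))" for k
  proof -
    obtain x where x: "x \<in> ell 4" "ell_norm 4 x = 1" "w k = pairing (T x) (duality_map x)"
      using w[of k] unfolding numerical_range_def by blast
    obtain s where "\<And>j. \<bar>j\<bar> \<le> int k \<Longrightarrow> norm (shift s x j) < 1 / real (Suc k)"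
      using exists_shift_small_near_0[OF x(1), of "1 / real (Suc k)" k] by auto
    with x show ?thesis
      by (intro exI[of _ "shift s x"])
        (auto simp: shift_in_ell_4 ell_norm_shift T duality_map_shift pairing_shift)
  qed
  then obtain X where X: "\<And>k. X k \<in> ell 4" "\<And>k. ell_norm 4 (X k) = 1"
    "\<And>k. pairing (T (X k)) (duality_map (X k)) = w k"
    and small: "\<And>k j. \<bar>j\<bar> \<le> int k \<Longrightarrow> norm (X k j) < 1 / real (Suc k)"
    by metis
  have "(\<lambda>k. X k j) \<longlonglongrightarrow> 0" for j
  proof (rule Lim_null_comparison)
    show "eventually (\<lambda>k. norm (X k j) \<le> 1 / real (Suc k)) sequentially"
      using eventually_ge_at_top[of "nat \<bar>j\<bar>"]
      by eventually_elim (rule less_imp_le[OF small], simp)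
    show "(\<lambda>k. 1 / real (Suc k)) \<longlonglongrightarrow> 0"
      by (rule LIMSEQ_Suc) (rule lim_1_over_n)
  qed
  then have "weakly_null X" by (rule weakly_null_if_coordinatewise_null[OF X(1,2)])
  then show "l \<in> essential_numerical_range T"
    unfolding essential_numerical_range_def using X lim by (intro CollectI exI[of _ X]) simp
qed

lemma essential_numerical_range_subset:
  "essential_numerical_range T \<subseteq> closure (numerical_range T)"
proof
  fix l assume "l \<in> essential_numerical_range T"
  then obtain X where "\<And>k. X k \<in> ell 4 \<and> ell_norm 4 (X k) = 1"
    and "(\<lambda>k. pairing (T (X k)) (duality_map (X k))) \<longlonglongrightarrow> l"
    unfolding essential_numerical_range_def by blast
  moreover from this(1) have "pairing (T (X k)) (duality_map (X k)) \<in> numerical_range T" for k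
    unfolding numerical_range_def by blast
  ultimately show "l \<in> closure (numerical_range T)"
    unfolding closure_sequential
    by (intro exI[of _ "\<lambda>k. pairing (T (X k)) (duality_map (X k))"]) simp
qed

section \<open>A disc in the numerical range\<close>

text \<open>On vectors supported on \<open>{0, 1}\<close> only the two off-diagonal entries \<open>\<plusminus>1 / pi\<close> of the
matrix matter. For a fixed ratio \<open>q\<close> of the moduli the values form an ellipse, scaled by
\<open>1 / pi\<close>, which is parametrized by the relative phase \<open>c + d * \<i>\<close>.\<close>

lemma two_point_vector_value:
  fixes r q c d :: real
  assumes r: "r ^ 4 * (1 + q ^ 4) = 1" and cd: "c\<^sup>2 + d\<^sup>2 = 1"
  defines "x \<equiv> (\<lambda>j::int. if j = 0 then complex_of_real r
             else if j = 1 then complex_of_real (r * q) * Complex c d else 0)"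
  shows "x \<in> ell 4" "ell_norm 4 x = 1"
    and "pairing (hilbert_sum x) (duality_map x) =
      complex_of_real (1 / pi) * Complex (- (q * (1 - q\<^sup>2) / (1 + q ^ 4)) * c) (- (q * (1 + q\<^sup>2) / (1 + q ^ 4)) * d)"
proof -
  have "finitely_supported x"
    unfolding finitely_supported_def by (rule finite_subset[of _ "{0, 1}"]) (auto simp: x_def)
  then show x: "x \<in> ell 4" by (rule finitely_supported_in_ell_4)
  have two: "(\<Sum>\<^sub>\<infinity>j. f j) = f 0 + f 1" if "\<And>j. j \<noteq> 0 \<Longrightarrow> j \<noteq> 1 \<Longrightarrow> f j = 0"
    for f :: "int \<Rightarrow> 'b::{topological_comm_monoid_add, t2_space}"
  proof -
    have "(\<Sum>\<^sub>\<infinity>j. f j) = (\<Sum>\<^sub>\<infinity>j\<in>{0, 1}. f j)"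
      using that by (intro infsum_cong_neutral) auto
    then show ?thesis by simp
  qed
  have unit: "norm (Complex c d) = 1" using cd by (simp add: cmod_def)
  have "ell_norm 4 x ^ 4 = r ^ 4 + (r * q) ^ 4"
    unfolding ell_norm_4_power4
    by (subst two) (auto simp: x_def norm_mult unit power_mult_distrib)
  also have "\<dots> = 1" using r by (simp add: algebra_simps)
  finally show "ell_norm 4 x = 1"
    using ell_norm_nonneg[of 4 x] power_eq_imp_eq_base[of "ell_norm 4 x" 4 1] by simp
  have h0: "hilbert_sum x 0 = complex_of_real (1 / pi) * (- (complex_of_real (r * q) * Complex c d))"
    unfolding hilbert_sum_eq_infsum_kernel by (subst two) (auto simp: x_def)
  have h1: "hilbert_sum x 1 = complex_of_real (1 / pi) * complex_of_real r"
    unfolding hilbert_sum_eq_infsum_kernel by (subst two) (auto simp: x_def)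
  have "pairing (hilbert_sum x) (duality_map x)
      = hilbert_sum x 0 * cnj (duality_map x 0) + hilbert_sum x 1 * cnj (duality_map x 1)"
    unfolding pairing_def by (rule two) (simp add: duality_map_def x_def)
  also have "\<dots> = complex_of_real (1 / pi) *
      (- (complex_of_real (r * q) * Complex c d) * cnj (duality_map x 0)
        + complex_of_real r * cnj (duality_map x 1))"
    unfolding h0 h1 by (simp only: mult.assoc distrib_left)
  also have "- (complex_of_real (r * q) * Complex c d) * cnj (duality_map x 0)
        + complex_of_real r * cnj (duality_map x 1)
      = Complex (- (r ^ 4 * (q * (1 - q\<^sup>2))) * c) (- (r ^ 4 * (q * (1 + q\<^sup>2))) * d)"
    by (simp add: duality_map_def x_def norm_mult unit complex_eq_iff power2_eq_square
        power4_eq_xxxx algebra_simps)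
  also have "r ^ 4 = 1 / (1 + q ^ 4)"
    using r by (metis nonzero_eq_divide_eq mult_zero_right zero_neq_one)
  finally show "pairing (hilbert_sum x) (duality_map x) =
      complex_of_real (1 / pi) * Complex (- (q * (1 - q\<^sup>2) / (1 + q ^ 4)) * c) (- (q * (1 + q\<^sup>2) / (1 + q ^ 4)) * d)"
    by simp
qed

text \<open>Every point of the disc lies on one of the ellipses with semi-axes
\<open>q * (1 - q\<^sup>2) / (1 + q ^ 4)\<close> and \<open>q * (1 + q\<^sup>2) / (1 + q ^ 4)\<close>,
\<open>0 \<le> q \<le> 1/2\<close>. For \<open>q = 1/2\<close> these are \<open>6/17\<close> and \<open>10/17\<close>, so the
ellipse surrounds the disc; for \<open>q = 0\<close> it is the origin. The intermediate value theorem
yields an ellipse through the given point.\<close>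

lemma ellipse_parameters:
  fixes u v :: real
  assumes uv: "u\<^sup>2 + v\<^sup>2 \<le> (6 / 17)\<^sup>2"
  obtains q c d :: real where "c\<^sup>2 + d\<^sup>2 = 1"
    "u = q * (1 - q\<^sup>2) / (1 + q ^ 4) * c" "v = q * (1 + q\<^sup>2) / (1 + q ^ 4) * d"
proof -
  \<comment> \<open>\<open>P q = 0\<close> is the equation of the ellipse at the point \<open>(u, v)\<close>, multiplied by the
    square of \<open>(1 - q\<^sup>2) * (1 + q\<^sup>2) * q / (1 + q ^ 4)\<close> so that it makes sense at \<open>q = 0\<close>.\<close>
  define P where "P q = ((1 - q\<^sup>2) * (1 + q\<^sup>2) * q / (1 + q ^ 4))\<^sup>2
      - u\<^sup>2 * (1 + q\<^sup>2)\<^sup>2 - v\<^sup>2 * (1 - q\<^sup>2)\<^sup>2" for q :: real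
  have pos: "1 + q ^ 4 > 0" for q :: real
    by (intro add_pos_nonneg) auto
  then have "continuous_on {0..1/2} P"
    unfolding P_def by (intro continuous_intros) (use pos in \<open>auto simp: less_le\<close>)
  moreover have "P 0 \<le> 0" by (simp add: P_def)
  moreover have "0 \<le> P (1/2)"
    using uv by (simp add: P_def power2_eq_square power4_eq_xxxx) (use zero_le_square[of v] in linarith)
  ultimately obtain q where q: "0 \<le> q" "q \<le> 1/2" "P q = 0"
    using IVT'[of P 0 0 "1/2"] by auto
  show ?thesis
  proof (cases "q = 0")
    case True
    with q(3) have "- u\<^sup>2 - v\<^sup>2 = 0" by (simp add: P_def)
    then have "u\<^sup>2 + v\<^sup>2 = 0" by linarith
    then have "u = 0" "v = 0" by (simp_all only: sum_power2_eq_zero_iff)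
    then show ?thesis using that[of 1 0 0] by simp
  next
    case False
    define a b where "a = q * (1 - q\<^sup>2) / (1 + q ^ 4)" and "b = q * (1 + q\<^sup>2) / (1 + q ^ 4)"
    have "q\<^sup>2 < 1" using power_mono[OF q(2,1), of 2] by (simp add: power2_eq_square)
    then have "a > 0" "b > 0"
      unfolding a_def b_def using q False pos[of q]
      by (auto intro!: divide_pos_pos mult_pos_pos add_pos_nonneg)
    have "(u / a)\<^sup>2 + (v / b)\<^sup>2 = 1"
    proof -
      define e where "e = q / (1 + q ^ 4)"
      define m p where "m = 1 - q\<^sup>2" and "p = 1 + q\<^sup>2"
      have ab: "a = m * e" "b = p * e" by (auto simp: a_def b_def e_def m_def p_def)
      have "(m * p * e)\<^sup>2 = u\<^sup>2 * p\<^sup>2 + v\<^sup>2 * m\<^sup>2"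
        using q(3) by (simp add: P_def e_def m_def p_def)
      then have "e\<^sup>2 * (m * p * e)\<^sup>2 = e\<^sup>2 * (u\<^sup>2 * p\<^sup>2 + v\<^sup>2 * m\<^sup>2)"
        by simp
      then have "a\<^sup>2 * b\<^sup>2 = u\<^sup>2 * b\<^sup>2 + v\<^sup>2 * a\<^sup>2"
        unfolding ab by (simp only: power_mult_distrib distrib_left mult_ac)
      moreover have "(u / a)\<^sup>2 + (v / b)\<^sup>2 = (u\<^sup>2 * b\<^sup>2 + v\<^sup>2 * a\<^sup>2) / (a\<^sup>2 * b\<^sup>2)"
        using \<open>a > 0\<close> \<open>b > 0\<close> by (simp add: add_divide_distrib power_divide)
      moreover have "a\<^sup>2 * b\<^sup>2 \<noteq> 0" using \<open>a > 0\<close> \<open>b > 0\<close> by simp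
      ultimately show ?thesis by (metis divide_self)
    qed
    then show ?thesis
      using \<open>a > 0\<close> \<open>b > 0\<close> by (intro that[of "u / a" "v / b" q]) (auto simp: a_def b_def)
  qed
qed

lemma disc_subset_numerical_range:
  "(\<lambda>z. complex_of_real (6 / (17 * pi)) * z) ` cball 0 1 \<subseteq> numerical_range (discrete_hilbert_transform 4)"
proof (rule image_subsetI)
  fix z :: complex assume "z \<in> cball 0 1"
  then have "(norm z)\<^sup>2 \<le> 1" by (simp add: power_le_one)
  then have "(6 / 17 * Re z)\<^sup>2 + (6 / 17 * Im z)\<^sup>2 \<le> (6 / 17)\<^sup>2"
    unfolding cmod_power2 by (simp add: power2_eq_square)
  then obtain q c d where cd: "c\<^sup>2 + d\<^sup>2 = 1"
    and uv: "6 / 17 * Re z = q * (1 - q\<^sup>2) / (1 + q ^ 4) * c" "6 / 17 * Im z = q * (1 + q\<^sup>2) / (1 + q ^ 4) * d"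
    by (rule ellipse_parameters)
  have pos: "1 + q ^ 4 > 0" by (intro add_pos_nonneg) auto
  define r where "r = root 4 (1 / (1 + q ^ 4))"
  have "r ^ 4 = 1 / (1 + q ^ 4)" unfolding r_def using pos by (intro real_root_pow_pos2) auto
  then have r: "r ^ 4 * (1 + q ^ 4) = 1" using pos by simp
  have "(- c)\<^sup>2 + (- d)\<^sup>2 = 1" using cd by simp
  note x = two_point_vector_value[OF r this]
  let ?x = "\<lambda>j::int. if j = 0 then complex_of_real r
      else if j = 1 then complex_of_real (r * q) * Complex (- c) (- d) else 0"
  have "complex_of_real (6 / (17 * pi)) * z = complex_of_real (1 / pi) * Complex (6 / 17 * Re z) (6 / 17 * Im z)"
    by (simp add: complex_eq_iff)
  also have "\<dots> = pairing (hilbert_sum ?x) (duality_map ?x)"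
    unfolding x(3) uv by (simp only: minus_mult_minus)
  finally show "complex_of_real (6 / (17 * pi)) * z \<in> numerical_range (discrete_hilbert_transform 4)"
    unfolding numerical_range_def discrete_hilbert_transform_4
    using x(1,2) by (intro CollectI exI[of _ ?x]) (simp only: restrict_apply' simp_thms)
qed

section \<open>The essential numerical range\<close>

theorem proposition4p12:
  defines "H \<equiv> discrete_hilbert_transform 4"
  shows "(\<lambda>z. complex_of_real (6 / (17 * pi)) * z) ` cball 0 1 \<subseteq> essential_numerical_range H
    \<and> essential_numerical_range H = closure (numerical_range H)
    \<and> interior (essential_numerical_range H) \<noteq> {}
    \<and> \<not> essential_numerical_range H \<subseteq> {z. Re z = 0}"
proof -
  let ?\<rho> = "6 / (17 * pi)"
  have "closure (numerical_range H) \<subseteq> essential_numerical_range H"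
    unfolding H_def discrete_hilbert_transform_4
    by (rule closure_numerical_range_subset) (simp add: shift_in_ell_4 hilbert_sum_shift)
  then have eq: "essential_numerical_range H = closure (numerical_range H)"
    using essential_numerical_range_subset[of H] by blast
  have disc: "(\<lambda>z. complex_of_real ?\<rho> * z) ` cball 0 1 \<subseteq> essential_numerical_range H"
    unfolding eq unfolding H_def
    by (rule order_trans[OF disc_subset_numerical_range closure_subset])
  have "cball 0 ?\<rho> \<subseteq> essential_numerical_range H"
  proof
    fix w :: complex assume "w \<in> cball 0 ?\<rho>"
    then have "w / complex_of_real ?\<rho> \<in> cball 0 1"
      by (simp add: norm_divide norm_mult field_simps)
    moreover have "w = complex_of_real ?\<rho> * (w / complex_of_real ?\<rho>)" by simp
    ultimately show "w \<in> essential_numerical_range H" using disc by blast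
  qed
  then have "ball 0 ?\<rho> \<subseteq> interior (essential_numerical_range H)"
    by (intro interior_maximal) (auto dest: subsetD[OF ball_subset_cball])
  then have "0 \<in> interior (essential_numerical_range H)"
    by (rule subsetD) simp
  moreover have "complex_of_real ?\<rho> * 1 \<in> essential_numerical_range H"
    by (rule subsetD[OF disc], rule imageI) simp
  then have "\<not> essential_numerical_range H \<subseteq> {z. Re z = 0}" by auto
  ultimately show ?thesis using disc eq by blast
qed

end
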